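(* Let $n\ge 1$, let $\Psi:\mathbb{R}\to\mathbb{R}$ be a non-negative convex function, and let $\mu$ be a positive Borel measure (not necessarily finite) on $\mathbb{R}^n\times\mathbb{R}^n$ with spherical cup $\hat\mu$. Then for any smooth function $f:\mathbb{R}^n\to\mathbb{R}$, $$\int_{\mathbb{R}^n\times\mathbb{R}^n}\Psi(f(y)-f(x))\,d\mu(x,y)\le\int_{\mathbb{R}^n\times\mathbb{R}^n}\Psi\Big(\frac{\pi}{2}\langle\nabla f(u),v\rangle\Big)\,d\hat\mu(u,v).$$
   Context: For $t\in[0,\pi/2]$ let $U_t:\mathbb{R}^n\times\mathbb{R}^n\to\mathbb{R}^n\times\mathbb{R}^n$ be the orthogonal linear map $U_t(x,y)=(x\cos t+y\sin t,\,-x\sin t+y\cos t)$, and let $\mu_t$ be the image (push-forward) of $\mu$ under $U_t$. The spherical cup of $\mu$ is the measure $\hat\mu=\frac{2}{\pi}\int_0^{\pi/2}\mu_t\,dt$ on $\mathbb{R}^n\times\mathbb{R}^n$, i.e. $\hat\mu(B)=\frac{2}{\pi}\int_0^{\pi/2}\mu_t(B)\,dt$ for Borel sets $B$. Here $\langle\cdot,\cdot\rangle$ is the Euclidean inner product on $\mathbb{R}^n$. Integrals of non-negative functions may take the value $+\infty$. *)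

theory Defs
  imports "HOL-Analysis.Analysis"
begin

definition gradient :: "('a::real_inner \<Rightarrow> real) \<Rightarrow> 'a \<Rightarrow> 'a" where
  "gradient f x = (THE D. GDERIV f x :> D)"


lemma gradient_eqI:
  assumes "GDERIV f x :> D"
  shows "gradient f x = D"
  unfolding gradient_def
proof (rule the_equality)
  show "GDERIV f x :> D" by fact
next
  fix E assume "GDERIV f x :> E"
  then have "(\<lambda>h. h \<bullet> E) = (\<lambda>h. h \<bullet> D)"
    using assms unfolding gderiv_def by (rule has_derivative_unique)
  then show "E = D"
    by (metis inner_commute vector_eq_ldot)
qed

text \<open>\<open>C_diff k f\<close>: the function \<open>f\<close> is of class $C^k$ on the whole space; the \<open>i\<close>-th partial
  derivative is the \<open>i\<close>-th component of the gradient.\<close>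

primrec C_diff :: "nat \<Rightarrow> (real ^ 'n \<Rightarrow> real) \<Rightarrow> bool" where
  "C_diff 0 f \<longleftrightarrow> continuous_on UNIV f"
| "C_diff (Suc k) f \<longleftrightarrow>
     (\<forall>x. f differentiable (at x)) \<and> (\<forall>i. C_diff k (\<lambda>x. gradient f x $ i))"

definition smooth :: "(real ^ 'n \<Rightarrow> real) \<Rightarrow> bool" where
  "smooth f \<longleftrightarrow> (\<forall>k. C_diff k f)"

text \<open>The map $U_t$ and the push-forward $\mu_t$.\<close>

definition rot :: "real \<Rightarrow> 'a :: real_vector \<times> 'a \<Rightarrow> 'a \<times> 'a" where
  "rot t = (\<lambda>(x, y). (cos t *\<^sub>R x + sin t *\<^sub>R y, - sin t *\<^sub>R x + cos t *\<^sub>R y))"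

lemma measurable_rot [measurable]:
  "rot t \<in> borel_measurable (borel :: ('a::euclidean_space \<times> 'a) measure)"
  unfolding rot_def case_prod_beta by (intro borel_measurable_continuous_onI continuous_intros)

definition rot_measure :: "('a \<times> 'a) measure \<Rightarrow> real \<Rightarrow> ('a \<times> 'a :: euclidean_space) measure" where
  "rot_measure M t = distr M borel (rot t)"

definition spherical_cup :: "('a \<times> 'a) measure \<Rightarrow> ('a \<times> 'a :: euclidean_space) measure" where
  "spherical_cup M = measure_of UNIV (sets borel)
     (\<lambda>B. ennreal (2 / pi) * (\<integral>\<^sup>+ t. emeasure (rot_measure M t) B \<partial>lebesgue_on {0..pi/2}))"

text \<open>The defining integral of \<open>spherical_cup\<close> makes sense only if $t \mapsto \mu_t(B)$ is measurable
  for every Borel set $B$. This is automatic for \<open>\<sigma>\<close>-finite measures, but it can fail otherwise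
  (e.g. $\mu(A) = \#(A \cap S)$ with $S = \{U_{-t}(p) : t \in T\}$ for a point $p \neq 0$ and a
  non-measurable $T \subseteq [0, \pi/2]$, where $\mu_t(\{p\}) = 1$ if $t \in T$ and $0$ otherwise). The library's \<open>nn_integral\<close> of a non-measurable function is a lower integral,
  which is not additive, and \<open>measure_of\<close> is the zero measure when its set function is not
  countably additive, so \<open>spherical_cup\<close> is meaningful only under this condition.\<close>

definition has_spherical_cup :: "('a \<times> 'a :: euclidean_space) measure \<Rightarrow> bool" where
  "has_spherical_cup M \<longleftrightarrow>
     (\<forall>B \<in> sets borel. (\<lambda>t. emeasure (rot_measure M t) B) \<in> borel_measurable (lebesgue_on {0..pi/2}))"

lemma emeasure_spherical_cup:
  assumes "has_spherical_cup M" and "B \<in> sets borel"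
  shows "emeasure (spherical_cup M) B =
     ennreal (2 / pi) * (\<integral>\<^sup>+ t. emeasure (rot_measure M t) B \<partial>lebesgue_on {0..pi/2})"
proof (rule emeasure_measure_of[OF spherical_cup_def])
  let ?m = "\<lambda>B. ennreal (2 / pi) * (\<integral>\<^sup>+ t. emeasure (rot_measure M t) B \<partial>lebesgue_on {0..pi/2})"
  show "B \<in> sets (spherical_cup M)"
    using assms(2) sets.sigma_sets_eq[of "borel :: ('a \<times> 'a) measure"]
    by (simp add: spherical_cup_def)
  show "positive (sets (spherical_cup M)) ?m"
    by (simp add: positive_def)
  show "countably_additive (sets (spherical_cup M)) ?m"
  proof (rule countably_additiveI)
    fix A :: "nat \<Rightarrow> ('a \<times> 'a) set"
    assume A: "range A \<subseteq> sets (spherical_cup M)" "disjoint_family A"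
    then have A_borel: "A i \<in> sets borel" for i
      using sets.sigma_sets_eq[of "borel :: ('a \<times> 'a) measure"]
      by (auto simp: spherical_cup_def)
    have "(\<Sum>i. ?m (A i)) = ennreal (2 / pi) *
        (\<integral>\<^sup>+ t. (\<Sum>i. emeasure (rot_measure M t) (A i)) \<partial>lebesgue_on {0..pi/2})"
      using assms(1) A_borel by (subst nn_integral_suminf) (auto simp: has_spherical_cup_def)
    also have "\<dots> = ?m (\<Union>i. A i)"
      using A A_borel by (subst suminf_emeasure) (auto simp: rot_measure_def)
    finally show "(\<Sum>i. ?m (A i)) = ?m (\<Union>i. A i)" .
  qed
qed auto

lemma sigma_finite_has_spherical_cup:
  fixes M :: "('a \<times> 'a :: euclidean_space) measure"
  assumes "sigma_finite_measure M" and [measurable_cong]: "sets M = sets borel"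
  shows "has_spherical_cup M"
  unfolding has_spherical_cup_def
proof
  interpret sigma_finite_measure M by fact
  fix B :: "('a \<times> 'a) set" assume [measurable]: "B \<in> sets borel"
  have [measurable]: "rot t \<in> borel_measurable M" for t by measurable
  have "(\<lambda>p::real \<times> 'a \<times> 'a. rot (fst p) (snd p)) \<in> borel_measurable borel"
    unfolding rot_def case_prod_beta
    by (intro borel_measurable_continuous_onI continuous_intros)
  moreover have "sets (lborel \<Otimes>\<^sub>M M) = sets (borel :: (real \<times> 'a \<times> 'a) measure)"
    using sets_pair_measure_cong[OF sets_lborel assms(2)] borel_prod by metis
  ultimately have [measurable]: "(\<lambda>p. rot (fst p) (snd p)) \<in> borel_measurable (lborel \<Otimes>\<^sub>M M)"
    by (simp cong: measurable_cong_sets)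
  have "(\<lambda>t. \<integral>\<^sup>+ p. indicator B (rot (fst (t, p)) (snd (t, p))) \<partial>M) \<in> borel_measurable lborel"
    by (rule borel_measurable_nn_integral_fst[where f = "\<lambda>p. indicator B (rot (fst p) (snd p))"]) measurable
  moreover have "emeasure (rot_measure M t) B = (\<integral>\<^sup>+ p. indicator B (rot t p) \<partial>M)" for t
  proof -
    have "emeasure (rot_measure M t) B = (\<integral>\<^sup>+ p. indicator B p \<partial>rot_measure M t)"
      by (simp add: rot_measure_def)
    also have "\<dots> = (\<integral>\<^sup>+ p. indicator B (rot t p) \<partial>M)"
      unfolding rot_measure_def by (rule nn_integral_distr) measurable
    finally show ?thesis .
  qed
  ultimately show "(\<lambda>t. emeasure (rot_measure M t) B) \<in> borel_measurable (lebesgue_on {0..pi/2})"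
    by (simp add: measurable_completion measurable_restrict_space1)
qed

end

theory Submission
  imports Defs
begin

text \<open>
  For a point \<open>p = (x, y)\<close> write \<open>(u\<^sub>t, v\<^sub>t) = rot t p\<close>. The curve \<open>u\<^sub>t = cos t x + sin t y\<close> joins
  \<open>x\<close> to \<open>y\<close> as \<open>t\<close> runs from \<open>0\<close> to \<open>pi / 2\<close>, and its velocity is exactly \<open>v\<^sub>t\<close>. Hence
  \<open>f y - f x\<close> is the integral of \<open>\<langle>\<nabla>f(u\<^sub>t), v\<^sub>t\<rangle>\<close> over \<open>[0, pi / 2]\<close>, that is, the mean of
  \<open>pi / 2 \<langle>\<nabla>f(u\<^sub>t), v\<^sub>t\<rangle>\<close>, and Jensen's inequality bounds \<open>\<Psi> (f y - f x)\<close> by the mean of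
  \<open>g (rot t p)\<close>, where \<open>g (u, v) = \<Psi> (pi / 2 \<langle>\<nabla>f(u), v\<rangle>)\<close>
  (\<open>convex_difference_le_rotation_mean\<close>). Integrating over \<open>p\<close> and exchanging the order of
  integration produces the integral of \<open>g\<close> against the spherical cup (\<open>nn_integral_spherical_cup\<close>).

  The delicate point is the exchange, because \<open>\<mu>\<close> need not be \<open>\<sigma>\<close>-finite. If the right-hand side is
  infinite there is nothing to show. Otherwise \<open>g \<circ> rot t\<close> has a finite integral for almost every
  \<open>t\<close>, so \<open>\<mu>\<close> is \<open>\<sigma>\<close>-finite on the set where \<open>g \<circ> rot t\<close> is nonzero. Since \<open>g (rot t p)\<close> depends
  continuously on \<open>t\<close> (a convex function on the whole line is continuous, and so is \<open>\<nabla>f\<close>), countably many of these sets suffice to cover every point \<open>p\<close> that contributes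
  to the left-hand side. Tonelli's theorem on their union gives the inequality
  (\<open>nn_integral_swap_le\<close>).
\<close>

section \<open>Exchanging integrals without \<open>\<sigma>\<close>-finiteness\<close>

text \<open>For each \<open>t\<close> in \<open>D\<close> the sets \<open>{1 / (k + 1) \<le> u t}\<close> have finite measure by Markov's
  inequality, and they exhaust the set where \<open>u t\<close> is nonzero; altogether these are countably many.\<close>

lemma sigma_finite_restrict_nonzero:
  fixes u :: "'i \<Rightarrow> 'a \<Rightarrow> ennreal"
  assumes D: "countable D"
    and meas [measurable]: "\<And>t. t \<in> D \<Longrightarrow> u t \<in> borel_measurable M"
    and fin: "\<And>t. t \<in> D \<Longrightarrow> (\<integral>\<^sup>+ p. u t p \<partial>M) < \<infinity>"
  shows "sigma_finite_measure (restrict_space M {p \<in> space M. \<exists>t\<in>D. u t p \<noteq> 0})"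
proof
  let ?S = "{p \<in> space M. \<exists>t\<in>D. u t p \<noteq> 0}"
  define L where "L = (\<lambda>(t, k). {p \<in> space M. 1 \<le> of_nat (Suc k) * u t p})"
  let ?A = "L ` (D \<times> UNIV)"
  have S: "?S \<in> sets M"
    using D meas by measurable
  have L_sets: "L (t, k) \<in> sets M" if "t \<in> D" for t k
    using meas[OF that] unfolding L_def by simp
  have L_sub: "L (t, k) \<subseteq> ?S" if "t \<in> D" for t k
    using that by (auto simp: L_def intro!: bexI[of _ t])
  have S_sub: "?S \<subseteq> \<Union>?A"
  proof
    fix p assume p: "p \<in> ?S"
    then obtain t where t: "t \<in> D" "u t p \<noteq> 0" and pM: "p \<in> space M" by auto
    obtain k where "1 \<le> of_nat (Suc k) * u t p"
    proof (cases "u t p")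
      case (real r)
      with t(2) have "0 < r" by (auto simp: less_le)
      then obtain k where "1 < of_nat k * r"
        using reals_Archimedean3 by blast
      also have "\<dots> \<le> of_nat (Suc k) * r"
        using \<open>0 < r\<close> by (simp add: algebra_simps)
      finally have "ennreal 1 \<le> ennreal (of_nat (Suc k) * r)"
        by (intro ennreal_leI) simp
      also have "\<dots> = of_nat (Suc k) * u t p"
        using real by (simp add: ennreal_mult ennreal_of_nat_eq_real_of_nat del: of_nat_Suc)
      finally show ?thesis using that by simp
    next
      case top
      then have "1 \<le> of_nat (Suc 0) * u t p" by simp
      then show ?thesis by (rule that)
    qed
    with t pM show "p \<in> \<Union>?A" by (auto simp: L_def)
  qed
  have L_fin: "emeasure M (L (t, k)) \<noteq> \<infinity>" if t: "t \<in> D" for t k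
  proof -
    have [measurable]: "u t \<in> borel_measurable M" using t by measurable
    have "emeasure M {p \<in> space M. 1 \<le> of_nat (Suc k) * u t p}
        \<le> of_nat (Suc k) * (\<integral>\<^sup>+ p. u t p * indicator (space M) p \<partial>M)"
      by (rule nn_integral_Markov_inequality) auto
    also have "(\<integral>\<^sup>+ p. u t p * indicator (space M) p \<partial>M) = (\<integral>\<^sup>+ p. u t p \<partial>M)"
      by (intro nn_integral_cong) auto
    also have "of_nat (Suc k) * (\<integral>\<^sup>+ p. u t p \<partial>M) < \<infinity>"
      using fin[OF t] by (simp add: ennreal_mult_less_top of_nat_less_top del: of_nat_Suc)
    finally show ?thesis by (simp add: L_def)
  qed
  have "\<Union>?A = ?S"
    using S_sub L_sub by blast
  moreover have "emeasure M a \<noteq> \<infinity>" if "a \<in> ?A" for a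
    using that L_fin by blast
  moreover have "a \<subseteq> ?S" "a \<in> sets M" if "a \<in> ?A" for a
    using that L_sub L_sets by blast+
  moreover have "countable ?A"
    using D by simp
  ultimately show "\<exists>A. countable A \<and> A \<subseteq> sets (restrict_space M ?S) \<and>
      \<Union>A = space (restrict_space M ?S) \<and> (\<forall>a\<in>A. emeasure (restrict_space M ?S) a \<noteq> \<infinity>)"
    using S by (intro exI[of _ ?A] conjI ballI subsetI)
      (simp_all add: sets_restrict_space_iff space_restrict_space2 emeasure_restrict_space)
qed

text \<open>When the right-hand side is finite, the sections \<open>h (t, \<cdot>)\<close> are integrable for all \<open>t\<close> in a
  set of full measure. A countable dense subset of it is enough: a point \<open>p\<close> at which all these
  countably many sections vanish has, by continuity, \<open>h (t, p) = 0\<close> for almost every \<open>t\<close>, and so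
  contributes nothing to the left-hand side. All other points lie in a \<open>\<sigma>\<close>-finite part of \<open>M\<close>.\<close>

lemma nn_integral_swap_le:
  fixes h :: "'b::{metric_space, second_countable_topology} \<times> 'a \<Rightarrow> ennreal"
  assumes N: "sigma_finite_measure N"
    and h [measurable]: "h \<in> borel_measurable (N \<Otimes>\<^sub>M M)"
    and cont: "\<And>p. p \<in> space M \<Longrightarrow> continuous_on UNIV (\<lambda>t. h (t, p))"
    and meas [measurable]: "(\<lambda>t. \<integral>\<^sup>+ p. h (t, p) \<partial>M) \<in> borel_measurable N"
  shows "(\<integral>\<^sup>+ p. (\<integral>\<^sup>+ t. h (t, p) \<partial>N) \<partial>M) \<le> (\<integral>\<^sup>+ t. (\<integral>\<^sup>+ p. h (t, p) \<partial>M) \<partial>N)"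
proof (cases "(\<integral>\<^sup>+ t. (\<integral>\<^sup>+ p. h (t, p) \<partial>M) \<partial>N) = \<infinity>")
  case False
  interpret N: sigma_finite_measure N by (rule N)
  define T where "T = {t \<in> space N. (\<integral>\<^sup>+ p. h (t, p) \<partial>M) < \<infinity>}"
  obtain D where D: "countable D" "D \<subseteq> T" "T \<subseteq> closure D"
    by (rule separable)
  define S where "S = {p \<in> space M. \<exists>t\<in>D. h (t, p) \<noteq> 0}"
  have section_meas [measurable]: "(\<lambda>p. h (t, p)) \<in> borel_measurable M" if "t \<in> space N" for t
    using that by measurable
  have S_sets: "S \<in> sets M"
  proof -
    have [measurable]: "(\<lambda>p. h (t, p)) \<in> borel_measurable M" if "t \<in> D" for t
      using that D(2) by (intro section_meas) (auto simp: T_def)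
    show ?thesis
      unfolding S_def using D(1) by measurable
  qed
  have "sigma_finite_measure (restrict_space M S)"
    unfolding S_def using D by (intro sigma_finite_restrict_nonzero) (auto simp: T_def)
  then interpret pair_sigma_finite N "restrict_space M S"
    by (simp add: pair_sigma_finite_def N)
  have AE_T: "AE t in N. t \<in> T"
    using nn_integral_noteq_infinite[OF meas] False by (auto simp: T_def less_top)
  have vanish: "(\<integral>\<^sup>+ t. h (t, p) \<partial>N) = 0" if p: "p \<in> space M" "p \<notin> S" for p
  proof -
    have "closed {t. h (t, p) = 0}"
      using continuous_closed_vimage[of "{0}" "\<lambda>t. h (t, p)"] cont[OF p(1)]
      by (simp add: vimage_def continuous_on_eq_continuous_at)
    moreover have "D \<subseteq> {t. h (t, p) = 0}"
      using p by (auto simp: S_def)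
    ultimately have "T \<subseteq> {t. h (t, p) = 0}"
      using D(3) closure_minimal by blast
    with AE_T have "AE t in N. h (t, p) = 0" by auto
    then have "(\<integral>\<^sup>+ t. h (t, p) \<partial>N) = (\<integral>\<^sup>+ t. 0 \<partial>N)" by (rule nn_integral_cong_AE)
    then show ?thesis by simp
  qed
  have id_meas: "(\<lambda>q. q) \<in> (N \<Otimes>\<^sub>M restrict_space M S) \<rightarrow>\<^sub>M (N \<Otimes>\<^sub>M M)"
    using measurable_Pair[OF measurable_fst
        measurable_compose[OF measurable_snd measurable_restrict_space1[OF measurable_ident]]]
    by (simp add: id_def)
  have h': "h \<in> borel_measurable (N \<Otimes>\<^sub>M restrict_space M S)"
    using measurable_compose[OF id_meas h] .
  have "(\<integral>\<^sup>+ p. (\<integral>\<^sup>+ t. h (t, p) \<partial>N) \<partial>M) = (\<integral>\<^sup>+ p. (\<integral>\<^sup>+ t. h (t, p) \<partial>N) * indicator S p \<partial>M)"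
    using vanish by (intro nn_integral_cong) (auto simp: indicator_def)
  also have "\<dots> = (\<integral>\<^sup>+ p. (\<integral>\<^sup>+ t. h (t, p) \<partial>N) \<partial>restrict_space M S)"
    using S_sets by (intro nn_integral_restrict_space[symmetric]) simp
  also have "\<dots> = (\<integral>\<^sup>+ t. (\<integral>\<^sup>+ p. h (t, p) \<partial>restrict_space M S) \<partial>N)"
    by (rule Fubini[OF h'])
  also have "\<dots> = (\<integral>\<^sup>+ t. (\<integral>\<^sup>+ p. h (t, p) * indicator S p \<partial>M) \<partial>N)"
    using S_sets by (intro nn_integral_cong nn_integral_restrict_space) simp
  also have "\<dots> \<le> (\<integral>\<^sup>+ t. (\<integral>\<^sup>+ p. h (t, p) \<partial>M) \<partial>N)"
    by (intro nn_integral_mono) (auto simp: indicator_def)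
  finally show ?thesis .
qed simp

section \<open>Integration against the spherical cup\<close>

text \<open>By linearity and monotone convergence the formula extends from indicator functions, where it
  is the definition of the spherical cup. Measurability in \<open>t\<close> has to be carried along in the same
  induction, since \<open>has_spherical_cup\<close> provides it for indicator functions only.\<close>

lemma nn_integral_spherical_cup:
  fixes M :: "('a \<times> 'a :: euclidean_space) measure" and g :: "'a \<times> 'a \<Rightarrow> ennreal"
  assumes cup: "has_spherical_cup M" and g: "g \<in> borel_measurable borel"
  shows "(\<lambda>t. \<integral>\<^sup>+ p. g p \<partial>rot_measure M t) \<in> borel_measurable (lebesgue_on {0..pi/2})"
    and "(\<integral>\<^sup>+ q. g q \<partial>spherical_cup M) =
      ennreal (2 / pi) * (\<integral>\<^sup>+ t. (\<integral>\<^sup>+ p. g p \<partial>rot_measure M t) \<partial>lebesgue_on {0..pi/2})"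
proof -
  let ?L = "lebesgue_on {0..pi/2}"
  have sets_cup [measurable_cong]: "sets (spherical_cup M) = sets borel"
    using sets.sigma_sets_eq[of "borel :: ('a \<times> 'a) measure"] by (simp add: spherical_cup_def)
  have sets_rot [measurable_cong]: "sets (rot_measure M t) = sets borel" for t
    by (simp add: rot_measure_def)
  have sp: "space (rot_measure M t) = UNIV" "space (spherical_cup M) = UNIV" for t
    by (auto simp: rot_measure_def spherical_cup_def)
  have "(\<lambda>t. \<integral>\<^sup>+ p. g p \<partial>rot_measure M t) \<in> borel_measurable ?L \<and>
    (\<integral>\<^sup>+ q. g q \<partial>spherical_cup M) =
      ennreal (2 / pi) * (\<integral>\<^sup>+ t. (\<integral>\<^sup>+ p. g p \<partial>rot_measure M t) \<partial>?L)"
    using g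
  proof (induction g rule: borel_measurable_induct)
    case (cong f g)
    then have "f = g" by auto
    with cong show ?case by simp
  next
    case (set A)
    with cup show ?case
      by (simp add: sets_rot sets_cup emeasure_spherical_cup has_spherical_cup_def)
  next
    case (mult u c)
    then have [measurable]: "(\<lambda>t. \<integral>\<^sup>+ p. u p \<partial>rot_measure M t) \<in> borel_measurable ?L"
      by simp
    have "(\<lambda>t. c * (\<integral>\<^sup>+ p. u p \<partial>rot_measure M t)) \<in> borel_measurable ?L"
      by measurable
    with mult show ?case
      by (simp add: nn_integral_cmult mult.left_commute)
  next
    case (add u v)
    then have [measurable]: "(\<lambda>t. \<integral>\<^sup>+ p. u p \<partial>rot_measure M t) \<in> borel_measurable ?L"
      "(\<lambda>t. \<integral>\<^sup>+ p. v p \<partial>rot_measure M t) \<in> borel_measurable ?L"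
      by simp_all
    have "(\<lambda>t. (\<integral>\<^sup>+ p. v p \<partial>rot_measure M t) + (\<integral>\<^sup>+ p. u p \<partial>rot_measure M t))
        \<in> borel_measurable ?L"
      by measurable
    with add show ?case
      by (simp add: nn_integral_add distrib_left)
  next
    case (seq U)
    note [measurable] = seq(1)
    have [measurable]: "(\<lambda>t. \<integral>\<^sup>+ p. U i p \<partial>rot_measure M t) \<in> borel_measurable ?L" for i
      using seq.IH by blast
    have SUP_meas: "(\<lambda>t. SUP i. \<integral>\<^sup>+ p. U i p \<partial>rot_measure M t) \<in> borel_measurable ?L"
      by measurable
    have SUP_rot: "(\<integral>\<^sup>+ p. (SUP i. U i) p \<partial>rot_measure M t)
        = (SUP i. \<integral>\<^sup>+ p. U i p \<partial>rot_measure M t)" for t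
      unfolding SUP_apply using seq by (intro nn_integral_monotone_convergence_SUP) auto
    have "(\<integral>\<^sup>+ q. (SUP i. U i) q \<partial>spherical_cup M) = (SUP i. \<integral>\<^sup>+ q. U i q \<partial>spherical_cup M)"
      unfolding SUP_apply using seq by (intro nn_integral_monotone_convergence_SUP) auto
    also have "\<dots> = ennreal (2 / pi) * (SUP i. \<integral>\<^sup>+ t. (\<integral>\<^sup>+ p. U i p \<partial>rot_measure M t) \<partial>?L)"
      using seq by (simp add: SUP_mult_left_ennreal)
    also have "(SUP i. \<integral>\<^sup>+ t. (\<integral>\<^sup>+ p. U i p \<partial>rot_measure M t) \<partial>?L)
        = (\<integral>\<^sup>+ t. (SUP i. \<integral>\<^sup>+ p. U i p \<partial>rot_measure M t) \<partial>?L)"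
      using seq by (intro nn_integral_monotone_convergence_SUP[symmetric])
        (auto simp: incseq_def le_fun_def intro!: nn_integral_mono)
    finally show ?case
      using SUP_meas unfolding SUP_rot by blast
  qed
  then show "(\<lambda>t. \<integral>\<^sup>+ p. g p \<partial>rot_measure M t) \<in> borel_measurable ?L"
    and "(\<integral>\<^sup>+ q. g q \<partial>spherical_cup M) =
      ennreal (2 / pi) * (\<integral>\<^sup>+ t. (\<integral>\<^sup>+ p. g p \<partial>rot_measure M t) \<partial>?L)"
    by auto
qed

section \<open>The pointwise inequality\<close>

text \<open>Jensen's inequality: integrate the supporting line of \<open>\<Psi>\<close> at the mean value of \<open>\<phi>\<close>.\<close>

lemma Jensen_integral_interval:
  fixes \<Psi> \<phi> :: "real \<Rightarrow> real"
  assumes \<Psi>: "convex_on UNIV \<Psi>" and ab: "a < b"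
    and \<phi>: "(\<phi> has_integral (b - a) * m) {a..b}"
    and int: "(\<lambda>t. \<Psi> (\<phi> t)) integrable_on {a..b}"
  shows "(b - a) * \<Psi> m \<le> integral {a..b} (\<lambda>t. \<Psi> (\<phi> t))"
proof -
  obtain c where c: "\<Psi> m + c * (s - m) \<le> \<Psi> s" for s
    using convex_le_Inf_differential[OF \<Psi>, of m] by auto
  have "((\<lambda>t. \<Psi> m + c * (\<phi> t - m)) has_integral
      (b - a) * \<Psi> m + c * ((b - a) * m - (b - a) * m)) {a..b}"
    using ab has_integral_const_real[of "\<Psi> m" a b] has_integral_const_real[of m a b]
    by (intro has_integral_add has_integral_mult_right has_integral_diff \<phi>) simp_all
  then have "((\<lambda>t. \<Psi> m + c * (\<phi> t - m)) has_integral (b - a) * \<Psi> m) {a..b}"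
    by simp
  then show ?thesis
    by (rule has_integral_le[OF _ integrable_integral[OF int]]) (rule c)
qed

lemma smooth_imp_GDERIV:
  assumes "smooth f"
  shows "GDERIV f x :> gradient f x"
proof -
  have "f differentiable (at x)"
    using assms unfolding smooth_def by (metis C_diff.simps(2))
  then obtain F where F: "(f has_derivative F) (at x)"
    by (auto simp: differentiable_def)
  \<comment> \<open>The derivative is a linear functional, represented by its values on the basis vectors.\<close>
  have "F h = h \<bullet> (\<Sum>b\<in>Basis. F b *\<^sub>R b)" for h
  proof -
    interpret linear F using F by (rule has_derivative_linear)
    have "F h = F (\<Sum>b\<in>Basis. (h \<bullet> b) *\<^sub>R b)" by (simp add: euclidean_representation)
    also have "\<dots> = (\<Sum>b\<in>Basis. (h \<bullet> b) * F b)" by (simp add: sum scale)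
    finally show ?thesis by (simp add: inner_sum_right mult.commute)
  qed
  then have "F = (\<lambda>h. h \<bullet> (\<Sum>b\<in>Basis. F b *\<^sub>R b))" by (rule ext)
  then have "GDERIV f x :> (\<Sum>b\<in>Basis. F b *\<^sub>R b)"
    using F by (simp add: gderiv_def)
  then show ?thesis using gradient_eqI by metis
qed

lemma smooth_imp_continuous_gradient:
  assumes "smooth f"
  shows "continuous_on UNIV (gradient f)"
proof -
  have "C_diff (Suc 0) f" using assms by (simp add: smooth_def)
  then show ?thesis
    using continuous_on_vec_lambda[of UNIV "\<lambda>i x. gradient f x $ i"] by simp
qed

lemma continuous_rotation_integrand:
  assumes "convex_on UNIV \<Psi>" and "smooth f"
  shows "continuous_on UNIV (\<lambda>q. \<Psi> (pi / 2 * (gradient f (fst q) \<bullet> snd q)))"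
proof -
  have "continuous_on UNIV \<Psi>" using assms(1) by (simp add: convex_on_continuous)
  then show ?thesis
    by (rule continuous_on_compose2)
      (auto intro!: continuous_intros
        continuous_on_compose2[OF smooth_imp_continuous_gradient[OF assms(2)]])
qed

lemma continuous_on_rot:
  "continuous_on UNIV (\<lambda>p::real \<times> 'a \<times> 'a::real_normed_vector. rot (fst p) (snd p))"
  unfolding rot_def case_prod_beta by (intro continuous_intros)

lemma continuous_on_rot_angle:
  "continuous_on UNIV (\<lambda>t. rot t (p :: 'a \<times> 'a::real_normed_vector))"
  unfolding rot_def case_prod_beta by (intro continuous_intros)

text \<open>The first component of \<open>rot t (x, y)\<close> runs from \<open>x\<close> to \<open>y\<close> along a path whose velocity is
  the second component.\<close>

lemma has_integral_gradient_along_rotation: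
  assumes "smooth f"
  shows "((\<lambda>t. gradient f (fst (rot t (x, y))) \<bullet> snd (rot t (x, y)))
    has_integral (f y - f x)) {0..pi/2}"
proof -
  define u where "u = (\<lambda>t. cos t *\<^sub>R x + sin t *\<^sub>R y)"
  define v where "v = (\<lambda>t. - sin t *\<^sub>R x + cos t *\<^sub>R y)"
  have u': "(u has_vector_derivative v t) (at t within {0..pi/2})" for t
    unfolding u_def v_def has_vector_derivative_def
    by (auto intro!: derivative_eq_intros simp: algebra_simps)
  have "((\<lambda>t. f (u t)) has_vector_derivative gradient f (u t) \<bullet> v t) (at t within {0..pi/2})" for t
  proof -
    have "(f has_derivative (\<lambda>h. h \<bullet> gradient f (u t))) (at (u t))"
      using smooth_imp_GDERIV[OF assms] by (simp add: gderiv_def)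
    from has_derivative_compose[OF u'[unfolded has_vector_derivative_def] this]
    show ?thesis by (simp add: has_vector_derivative_def inner_commute)
  qed
  then have "((\<lambda>t. gradient f (u t) \<bullet> v t) has_integral (f (u (pi/2)) - f (u 0))) {0..pi/2}"
    by (intro fundamental_theorem_of_calculus) auto
  then show ?thesis by (simp add: rot_def u_def v_def)
qed

lemma nn_integral_lebesgue_on_continuous:
  fixes g :: "real \<Rightarrow> real"
  assumes "continuous_on {a..b} g" and "\<And>t. 0 \<le> g t"
  shows "(\<integral>\<^sup>+ t. ennreal (g t) \<partial>lebesgue_on {a..b}) = ennreal (integral {a..b} g)"
proof -
  have "(g has_integral integral {a..b} g) {a..b}"
    using assms(1) by (intro integrable_integral integrable_continuous_real)
  from nn_integral_has_integral_lebesgue'[OF _ this] assms(2)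
  show ?thesis
    by (simp add: nn_integral_restrict_space nn_integral_completion)
qed

text \<open>The difference \<open>f y - f x\<close> is the mean over \<open>[0, pi / 2]\<close> of \<open>pi / 2\<close> times the directional
  derivative, which explains the constants.\<close>

lemma convex_difference_le_rotation_mean:
  fixes p :: "(real ^ 'n) \<times> (real ^ 'n)"
  assumes nonneg: "\<And>s. 0 \<le> \<Psi> s" and \<Psi>: "convex_on UNIV \<Psi>" and f: "smooth f"
  defines "g \<equiv> \<lambda>q. \<Psi> (pi / 2 * (gradient f (fst q) \<bullet> snd q))"
  shows "ennreal (\<Psi> (f (snd p) - f (fst p)))
    \<le> ennreal (2 / pi) * (\<integral>\<^sup>+ t. ennreal (g (rot t p)) \<partial>lebesgue_on {0..pi/2})"
proof -
  let ?m = "f (snd p) - f (fst p)"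
  have cont: "continuous_on {0..pi/2} (\<lambda>t. g (rot t p))"
    using continuous_on_compose2[OF continuous_rotation_integrand[OF \<Psi> f] continuous_on_rot_angle]
    unfolding g_def by (rule continuous_on_subset) auto
  have "((\<lambda>t. pi / 2 * (gradient f (fst (rot t p)) \<bullet> snd (rot t p)))
      has_integral (pi / 2 - 0) * ?m) {0..pi/2}"
    using has_integral_mult_right[OF has_integral_gradient_along_rotation[OF f], of "pi/2" "fst p" "snd p"]
    by simp
  from Jensen_integral_interval[OF \<Psi> _ this] cont
  have "pi / 2 * \<Psi> ?m \<le> integral {0..pi/2} (\<lambda>t. g (rot t p))"
    by (simp add: g_def integrable_continuous_real)
  then have "\<Psi> ?m \<le> 2 / pi * integral {0..pi/2} (\<lambda>t. g (rot t p))"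
    by (simp add: field_simps)
  then have "ennreal (\<Psi> ?m) \<le> ennreal (2 / pi * integral {0..pi/2} (\<lambda>t. g (rot t p)))"
    by (rule ennreal_leI)
  also have "\<dots> = ennreal (2 / pi) * (\<integral>\<^sup>+ t. ennreal (g (rot t p)) \<partial>lebesgue_on {0..pi/2})"
    using nn_integral_lebesgue_on_continuous[OF cont] nonneg
    by (simp add: g_def ennreal_mult'[of "2 / pi", symmetric])
  finally show ?thesis .
qed

section \<open>The inequality for the spherical cup\<close>

theorem theorem2p2:
  fixes \<Psi> :: "real \<Rightarrow> real"
    and \<mu> :: "((real ^ 'n) \<times> (real ^ 'n)) measure"
    and f :: "real ^ 'n \<Rightarrow> real"
  assumes "\<forall>s. 0 \<le> \<Psi> s"
    and "convex_on UNIV \<Psi>"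
    and "sets \<mu> = sets borel"
    and "has_spherical_cup \<mu>"
    and "smooth f"
  shows "(\<integral>\<^sup>+ (x, y). ennreal (\<Psi> (f y - f x)) \<partial>\<mu>)
       \<le> (\<integral>\<^sup>+ (u, v). ennreal (\<Psi> (pi / 2 * (gradient f u \<bullet> v))) \<partial>spherical_cup \<mu>)"
proof -
  let ?L = "lebesgue_on {0..pi/2}"
  define g where "g = (\<lambda>q. \<Psi> (pi / 2 * (gradient f (fst q) \<bullet> snd q)))"
  have g_cont: "continuous_on UNIV g"
    unfolding g_def by (rule continuous_rotation_integrand[OF assms(2,5)])
  have g_meas: "(\<lambda>q. ennreal (g q)) \<in> borel_measurable borel"
    using measurable_compose[OF borel_measurable_continuous_onI[OF g_cont] measurable_ennreal] .
  have rot_meas: "rot t \<in> \<mu> \<rightarrow>\<^sub>M borel" for t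
    using measurable_rot measurable_cong_sets[OF assms(3) refl] by blast
  have rot_int: "(\<integral>\<^sup>+ q. ennreal (g q) \<partial>rot_measure \<mu> t) = (\<integral>\<^sup>+ p. ennreal (g (rot t p)) \<partial>\<mu>)" for t
    unfolding rot_measure_def using rot_meas g_meas by (intro nn_integral_distr) auto
  have L: "sigma_finite_measure ?L"
    by (intro finite_measure.axioms(1) finite_measure_lebesgue_on) simp
  have "(\<lambda>z. z) \<in> ?L \<Otimes>\<^sub>M \<mu> \<rightarrow>\<^sub>M (borel \<Otimes>\<^sub>M borel)"
  proof (rule measurable_pair)
    have "(\<lambda>t::real. t) \<in> ?L \<rightarrow>\<^sub>M borel"
      by (intro measurable_restrict_space1 measurable_completion) simp
    then show "fst \<circ> (\<lambda>z. z) \<in> ?L \<Otimes>\<^sub>M \<mu> \<rightarrow>\<^sub>M borel"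
      using measurable_compose[OF measurable_fst] by (auto simp: comp_def)
    show "snd \<circ> (\<lambda>z. z) \<in> ?L \<Otimes>\<^sub>M \<mu> \<rightarrow>\<^sub>M borel"
      using measurable_snd[of ?L \<mu>] measurable_cong_sets[OF refl assms(3)] by (auto simp: comp_def)
  qed
  then have id_meas: "(\<lambda>z. z) \<in> ?L \<Otimes>\<^sub>M \<mu> \<rightarrow>\<^sub>M borel"
    by (simp add: borel_prod)
  have joint_borel: "(\<lambda>z. ennreal (g (rot (fst z) (snd z)))) \<in> borel_measurable borel"
    using measurable_compose[OF borel_measurable_continuous_onI[OF continuous_on_rot] g_meas] .
  have joint: "(\<lambda>z. ennreal (g (rot (fst z) (snd z)))) \<in> borel_measurable (?L \<Otimes>\<^sub>M \<mu>)"
    using measurable_compose[OF id_meas joint_borel] .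
  have swap: "(\<integral>\<^sup>+ p. (\<integral>\<^sup>+ t. ennreal (g (rot t p)) \<partial>?L) \<partial>\<mu>)
      \<le> (\<integral>\<^sup>+ t. (\<integral>\<^sup>+ p. ennreal (g (rot t p)) \<partial>\<mu>) \<partial>?L)"
    using nn_integral_swap_le[OF L joint] nn_integral_spherical_cup(1)[OF assms(4) g_meas]
      continuous_on_compose2[OF g_cont continuous_on_rot_angle]
    by (simp add: rot_int continuous_on_ennreal)
  interpret L: sigma_finite_measure ?L by (rule L)
  have inner_meas: "(\<lambda>p. \<integral>\<^sup>+ t. ennreal (g (rot t p)) \<partial>?L) \<in> borel_measurable \<mu>"
    using measurable_compose[OF measurable_pair_swap' joint]
    by (intro L.borel_measurable_nn_integral) (simp add: case_prod_beta')
  have "(\<integral>\<^sup>+ (x, y). ennreal (\<Psi> (f y - f x)) \<partial>\<mu>)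
      \<le> (\<integral>\<^sup>+ p. ennreal (2 / pi) * (\<integral>\<^sup>+ t. ennreal (g (rot t p)) \<partial>?L) \<partial>\<mu>)"
    unfolding g_def case_prod_beta using assms
    by (intro nn_integral_mono convex_difference_le_rotation_mean) auto
  also have "\<dots> = ennreal (2 / pi) * (\<integral>\<^sup>+ p. (\<integral>\<^sup>+ t. ennreal (g (rot t p)) \<partial>?L) \<partial>\<mu>)"
    by (rule nn_integral_cmult[OF inner_meas])
  also have "\<dots> \<le> ennreal (2 / pi) * (\<integral>\<^sup>+ t. (\<integral>\<^sup>+ p. ennreal (g (rot t p)) \<partial>\<mu>) \<partial>?L)"
    by (intro mult_left_mono swap) simp
  also have "\<dots> = (\<integral>\<^sup>+ q. ennreal (g q) \<partial>spherical_cup \<mu>)"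
    using nn_integral_spherical_cup(2)[OF assms(4) g_meas] by (simp add: rot_int)
  finally show ?thesis by (simp add: g_def case_prod_beta')
qed

end
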